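(* Let $\theta=(f,p,G)$ and $\hat\theta=(\hat f,\hat p,\hat G)$ be two graphical latent models. Suppose $\theta\sim^{z,a}_{\rm con}\hat\theta$ and that $G=[G^z,G^a]$ satisfies the graphical criterion: for all $i\in[d_z]$, $$\Big(\bigcap_{j\in\mathrm{Ch}^z_i}\mathrm{Pa}^z_j\Big)\cap\Big(\bigcap_{j\in\mathrm{Pa}^z_i}\mathrm{Ch}^z_j\Big)\cap\Big(\bigcap_{\ell\in\mathrm{Pa}^a_i}\mathrm{Ch}^a_\ell\Big)=\{i\}.$$ Then $\theta\sim_{\rm perm}\hat\theta$ (equivalence up to permutation).
   Context: **Notation.** $[n]=\{1,\dots,n\}$. Fix positive integers $T,d_x,d_z,d_a$ with $d_z\le d_x$, a constant $\sigma^2\ge0$ and a nonempty set $\mathcal A\subseteq\mathbb R^{d_a}$. Write $z^{<t}=(z^1,\dots,z^{t-1})\in\mathbb R^{d_z\times(t-1)}$ and $a^{<t}=(a^0,\dots,a^{t-1})\in\mathcal A^t$ (columns indexed by time). For $B\in\{0,1\}^{m\times n}$, $\mathbb R^{m\times n}_B=\{M\in\mathbb R^{m\times n}:B_{i,j}=0\Rightarrow M_{i,j}=0\}$. A map defined on an arbitrary subset of $\mathbb R^n$ is $C^1$ if it extends to a $C^1$ map on an open set containing that subset. A diffeomorphism is a $C^1$ bijection with $C^1$ inverse. A permutation matrix is identified with the linear map it defines. **Graphical latent model.** A triple $\theta=(f,p,G)$, $G=[G^z,G^a]$, $G^z\in\{0,1\}^{d_z\times d_z}$, $G^a\in\{0,1\}^{d_z\times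 d_a}$, such that: (i) $f:\mathbb R^{d_z}\to\mathbb R^{d_x}$ is a diffeomorphism onto its image, and $f(\mathbb R^{d_z})$ is closed in $\mathbb R^{d_x}$; observations are $x^t=f(z^t)+n^t$, $t\in[T]$, where the $n^t\sim\mathcal N(0,\sigma^2I)$ are independent across time and independent of all $z$'s and $a$'s; (ii) for each $t\in[T]$, $z^t$ has, given $z^{<t}$ and $a^{<t}$, a conditional density with respect to Lebesgue measure $p(z^t\mid z^{<t},a^{<t})=\prod_{i=1}^{d_z}p(z^t_i\mid z^{<t},a^{<t})$, each factor having support $\mathbb R$ (for $t=1$ the conditioning is on $a^0$ only); (iii) for each $i$ and $t$, $p(z^t_i\mid z^{<t},a^{<t})$ depends on $(z^{<t},a^{<t})$ only through the rows $z_j^{<t}$ with $G^z_{i,j}=1$ and the rows $a_\ell^{<t}$ with $G^a_{i,\ell}=1$. **Parents and children.** $\mathrm{Pa}^z_i=\{j\in[d_z]:G^z_{i,j}=1\}$, $\mathrm{Ch}^z_i=\{j\in[d_z]:G^z_{j,i}=1\}$, $\mathrm{Pa}^a_i=\{\ell\in[d_a]:G^a_{i,\ell}=1\}$, $\mathrm{Ch}^a_\ell=\{i\in[d_z]:G^a_{i,\ell}=1\}$. An intersection over an empty index set is $[d_z]$. **Equivalence up to diffeomorphism.** $\theta\sim_{\rm diff}\tilde\theta$ iff $f(\mathbb R^{d_z})=\tilde f(\mathbb R^{d_z})$ and, with $v:=f^{-1}\circ\tilde f$ (a diffeomorphism of $\mathbb R^{d_z}$), for all $t\in[T]$, $a^{<t}\in\mathcal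 A^t$, $z^{\le t}\in\mathbb R^{d_z\times t}$: $\tilde p(z^t\mid z^{<t},a^{<t})=p(v(z^t)\mid v(z^{<t}),a^{<t})\,|\det Dv(z^t)|$, where $v$ is applied columnwise to $z^{<t}$. **$G$-preservation.** The dependency graph of $h:\mathbb R^n\to\mathbb R^m$ is $H\in\{0,1\}^{m\times n}$ with $H_{i,j}=0$ iff $h_i$ does not depend on its $j$-th argument. For $B\in\{0,1\}^{m\times n}$, a matrix $C\in\mathbb R^{m\times m}$ is $B$-preserving if $C^\top\mathbb R^{m\times n}_B\subseteq\mathbb R^{m\times n}_B$; a function $c:\mathbb R^m\to\mathbb R^m$ is $B$-preserving if its dependency graph is a $B$-preserving matrix. **Relations.** Let $v=f^{-1}\circ\tilde f$. - $\theta\sim^{z,a}_{\rm con}\tilde\theta$ iff $\theta\sim_{\rm diff}\tilde\theta$ and there is a permutation matrix $P$ with $\tilde G^a=PG^a$, $\tilde G^z=PG^zP^\top$, and $v=c\circ P^\top$ for some diffeomorphism $c$ that is $G^a$-, $G^z$- and $(G^z)^\top$-preserving. - $\theta\sim_{\rm perm}\tilde\theta$ iff $\theta\sim_{\rm diff}\tilde\theta$ and there is a permutation matrix $P$ with $\tilde G^a=PG^a$, $\tilde G^z=PG^zP^\top$, and $v=d\circ P^\top$ where $d$ is element-wise, i.e. $d_i(z)$ depends only on $z_i$ for every $i$. *)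

theory Defs
  imports "HOL-Probability.Probability"
begin

section \<open>C1 maps and diffeomorphisms\<close>

definition C1_on :: "(real^'n) set \<Rightarrow> (real^'n \<Rightarrow> real^'m) \<Rightarrow> bool" where
  "C1_on S f \<longleftrightarrow>
     (\<exists>U g (g' :: real^'n \<Rightarrow> (real^'n) \<Rightarrow>\<^sub>L (real^'m)).
        open U \<and> S \<subseteq> U \<and> (\<forall>x\<in>S. g x = f x) \<and>
        (\<forall>x\<in>U. (g has_derivative blinfun_apply (g' x)) (at x)) \<and>
        continuous_on U g')"

definition diffeomorphism_on ::
    "(real^'n) set \<Rightarrow> (real^'m) set \<Rightarrow> (real^'n \<Rightarrow> real^'m) \<Rightarrow> bool" where
  "diffeomorphism_on S S' f \<longleftrightarrow>
     bij_betw f S S' \<and> C1_on S f \<and> C1_on S' (inv_into S f)"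


section \<open>Binary matrices, dependency graphs and preservation\<close>

text \<open>
  Adjacency matrices are real matrices with entries in \<open>{0, 1}\<close>, with rows and columns indexed
  by finite types. They can then be multiplied by permutation matrices and transposed literally.
\<close>

definition binary_matrix :: "real^'n^'m \<Rightarrow> bool" where
  "binary_matrix B \<longleftrightarrow> (\<forall>i j. B $ i $ j \<in> {0, 1})"

definition permutation_matrix :: "real^'n^'n \<Rightarrow> bool" where
  "permutation_matrix P \<longleftrightarrow>
     (\<exists>\<pi>. \<pi> permutes UNIV \<and> P = (\<chi> i j. if j = \<pi> i then 1 else 0))"

definition masked_matrices :: "real^'n^'m \<Rightarrow> (real^'n^'m) set" where
  "masked_matrices B = {M. \<forall>i j. B $ i $ j = 0 \<longrightarrow> M $ i $ j = 0}"

definition depends_on_arg :: "(real^'n \<Rightarrow> real^'m) \<Rightarrow> 'm \<Rightarrow> 'n \<Rightarrow> bool" where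
  "depends_on_arg h i j \<longleftrightarrow>
     (\<exists>x y. (\<forall>k. k \<noteq> j \<longrightarrow> x $ k = y $ k) \<and> h x $ i \<noteq> h y $ i)"

definition dependency_graph :: "(real^'n \<Rightarrow> real^'m) \<Rightarrow> real^'n^'m" where
  "dependency_graph h = (\<chi> i j. if depends_on_arg h i j then 1 else 0)"

definition matrix_preserving :: "real^'n^'m \<Rightarrow> real^'m^'m \<Rightarrow> bool" where
  "matrix_preserving B C \<longleftrightarrow>
     (\<lambda>M. transpose C ** M) ` masked_matrices B \<subseteq> masked_matrices B"

definition fun_preserving :: "real^'n^'m \<Rightarrow> (real^'m \<Rightarrow> real^'m) \<Rightarrow> bool" where
  "fun_preserving B c \<longleftrightarrow> matrix_preserving B (dependency_graph c)"

definition elementwise :: "(real^'n \<Rightarrow> real^'n) \<Rightarrow> bool" where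
  "elementwise d \<longleftrightarrow> (\<forall>i x y. x $ i = y $ i \<longrightarrow> d x $ i = d y $ i)"


section \<open>Graphical latent models\<close>

text \<open>
  The dimensions are the cardinalities of the finite index types: \<open>'x\<close> for observations, \<open>'z\<close>
  for latents, \<open>'a\<close> for actions. \<open>trans \<theta> t z a y\<close> is the joint conditional density at \<open>y\<close> of the
  latent at time \<open>t\<close>, given the past latents \<open>z\<close> at times \<open>1, ..., t - 1\<close> and the past actions
  \<open>a\<close> at times \<open>0, ..., t - 1\<close>. Pasts are extensional functions of time.
\<close>

record ('x, 'z, 'a) latent_triple =
  mixing :: "real^'z \<Rightarrow> real^'x"
  trans :: "nat \<Rightarrow> (nat \<Rightarrow> real^'z) \<Rightarrow> (nat \<Rightarrow> real^'a) \<Rightarrow> real^'z \<Rightarrow> real"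
  Gz :: "real^'z^'z"
  Ga :: "real^'a^'z"

definition latent_pasts :: "nat \<Rightarrow> (nat \<Rightarrow> real^'z) set" where
  "latent_pasts t = {1..<t} \<rightarrow>\<^sub>E UNIV"

definition action_pasts :: "(real^'a) set \<Rightarrow> nat \<Rightarrow> (nat \<Rightarrow> real^'a) set" where
  "action_pasts \<A> t = {..<t} \<rightarrow>\<^sub>E \<A>"

definition past_algebra ::
    "(real^'a) set \<Rightarrow> nat \<Rightarrow> ((nat \<Rightarrow> real^'z) \<times> (nat \<Rightarrow> real^'a)) measure" where
  "past_algebra \<A> t =
     (\<Pi>\<^sub>M s\<in>{1..<t}. borel) \<Otimes>\<^sub>M (\<Pi>\<^sub>M s\<in>{..<t}. restrict_space borel \<A>)"

text \<open>
  The law \<open>N(0, \<sigma>\<^sup>2 I)\<close>, as the image of a standard Gaussian vector under multiplication by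
  \<open>\<sigma>\<close>; for \<open>\<sigma>\<^sup>2 = 0\<close> this is the point mass at the origin.
\<close>

definition isotropic_gaussian :: "real \<Rightarrow> (real^'x) measure" where
  "isotropic_gaussian \<sigma>2 =
     distr (\<Pi>\<^sub>M j\<in>UNIV. density lborel (\<lambda>e. ennreal (std_normal_density e))) borel
       (\<lambda>e. \<chi> j. sqrt \<sigma>2 * e j)"

text \<open>
  Random variables generated by \<open>f\<close> and \<open>p\<close>: latents \<open>Z\<close>, actions \<open>A\<close>, noise \<open>N\<close> and
  observations \<open>X\<close>. That \<open>p t\<close> is a conditional density of \<open>Z t\<close> given the past means that it is
  the density of the joint law of the past and \<open>Z t\<close> with respect to the product of the law of
  the past and Lebesgue measure. Independence of the noise from the latents and actions is stated
  with generated sigma-algebras because \<open>indep_var\<close> needs both variables to have the same type.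
\<close>

locale latent_process = prob_space M
  for M :: "'w measure" +
  fixes T :: nat
    and \<sigma>2 :: real
    and \<A> :: "(real^'a) set"
    and f :: "real^'z \<Rightarrow> real^'x"
    and p :: "nat \<Rightarrow> (nat \<Rightarrow> real^'z) \<Rightarrow> (nat \<Rightarrow> real^'a) \<Rightarrow> real^'z \<Rightarrow> real"
    and Z :: "nat \<Rightarrow> 'w \<Rightarrow> real^'z"
    and A :: "nat \<Rightarrow> 'w \<Rightarrow> real^'a"
    and N :: "nat \<Rightarrow> 'w \<Rightarrow> real^'x"
    and X :: "nat \<Rightarrow> 'w \<Rightarrow> real^'x"
  assumes Z_measurable: "\<And>t. t \<in> {1..T} \<Longrightarrow> Z t \<in> M \<rightarrow>\<^sub>M borel"
    and A_measurable: "\<And>t. t \<in> {..<T} \<Longrightarrow> A t \<in> M \<rightarrow>\<^sub>M restrict_space borel \<A>"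
    and N_measurable: "\<And>t. t \<in> {1..T} \<Longrightarrow> N t \<in> M \<rightarrow>\<^sub>M borel"
    and p_measurable: "\<And>t. t \<in> {1..T} \<Longrightarrow>
          (\<lambda>((z, a), y). p t z a y) \<in> borel_measurable (past_algebra \<A> t \<Otimes>\<^sub>M borel)"
    and Z_conditional_density: "\<And>t. t \<in> {1..T} \<Longrightarrow>
          distr M (past_algebra \<A> t \<Otimes>\<^sub>M borel)
            (\<lambda>\<omega>. ((\<lambda>s\<in>{1..<t}. Z s \<omega>, \<lambda>s\<in>{..<t}. A s \<omega>), Z t \<omega>)) =
          density
            (distr M (past_algebra \<A> t) (\<lambda>\<omega>. (\<lambda>s\<in>{1..<t}. Z s \<omega>, \<lambda>s\<in>{..<t}. A s \<omega>)) \<Otimes>\<^sub>M lborel)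
            (\<lambda>((z, a), y). ennreal (p t z a y))"
    and N_gaussian: "\<And>t. t \<in> {1..T} \<Longrightarrow> distr M borel (N t) = isotropic_gaussian \<sigma>2"
    and N_indep_time: "indep_vars (\<lambda>_. borel) N {1..T}"
    and N_indep_latents_actions:
          "indep_set
             (sets (vimage_algebra (space M) (\<lambda>\<omega>. \<lambda>t\<in>{1..T}. N t \<omega>) (\<Pi>\<^sub>M t\<in>{1..T}. borel)))
             (sets (vimage_algebra (space M)
                (\<lambda>\<omega>. (\<lambda>t\<in>{1..T}. Z t \<omega>, \<lambda>t\<in>{..<T}. A t \<omega>))
                ((\<Pi>\<^sub>M t\<in>{1..T}. borel) \<Otimes>\<^sub>M (\<Pi>\<^sub>M t\<in>{..<T}. restrict_space borel \<A>))))"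
    and X_eq: "\<And>t \<omega>. t \<in> {1..T} \<Longrightarrow> \<omega> \<in> space M \<Longrightarrow> X t \<omega> = f (Z t \<omega>) + N t \<omega>"

text \<open>
  A family \<open>q\<close> of conditional densities of the individual coordinates, as required of the factors
  of the transition density. The support of a density is the closure of the set where it does not
  vanish.
\<close>

definition coordinate_densities ::
    "nat \<Rightarrow> (real^'a) set
      \<Rightarrow> (nat \<Rightarrow> (nat \<Rightarrow> real^'z) \<Rightarrow> (nat \<Rightarrow> real^'a) \<Rightarrow> 'z \<Rightarrow> real \<Rightarrow> real) \<Rightarrow> bool" where
  "coordinate_densities T \<A> q \<longleftrightarrow>
     (\<forall>t\<in>{1..T}. \<forall>z\<in>latent_pasts t. \<forall>a\<in>action_pasts \<A> t. \<forall>i.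
        q t z a i \<in> borel_measurable borel \<and>
        (\<forall>u. 0 \<le> q t z a i u) \<and>
        (\<integral>\<^sup>+ u. ennreal (q t z a i u) \<partial>lborel) = 1 \<and>
        closure {u. q t z a i u \<noteq> 0} = UNIV)"

definition respects_graphs ::
    "nat \<Rightarrow> (real^'a) set \<Rightarrow> real^'z^'z \<Rightarrow> real^'a^'z
      \<Rightarrow> (nat \<Rightarrow> (nat \<Rightarrow> real^'z) \<Rightarrow> (nat \<Rightarrow> real^'a) \<Rightarrow> 'z \<Rightarrow> real \<Rightarrow> real) \<Rightarrow> bool" where
  "respects_graphs T \<A> Hz Ha q \<longleftrightarrow>
     (\<forall>t\<in>{1..T}. \<forall>i.
        \<forall>z\<in>latent_pasts t. \<forall>z'\<in>latent_pasts t. \<forall>a\<in>action_pasts \<A> t. \<forall>a'\<in>action_pasts \<A> t.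
          (\<forall>j. Hz $ i $ j = 1 \<longrightarrow> (\<forall>s\<in>{1..<t}. z s $ j = z' s $ j)) \<longrightarrow>
          (\<forall>l. Ha $ i $ l = 1 \<longrightarrow> (\<forall>s\<in>{..<t}. a s $ l = a' s $ l)) \<longrightarrow>
          q t z a i = q t z' a' i)"

text \<open>
  The sample space of the process is fixed to the type of trajectories of latents, actions and
  noise because a definition cannot quantify over types; the joint law of every such process can
  be realised on it.
\<close>

definition graphical_latent_model ::
    "nat \<Rightarrow> real \<Rightarrow> (real^'a) set \<Rightarrow> ('x::finite, 'z::finite, 'a::finite) latent_triple \<Rightarrow> bool" where
  "graphical_latent_model T \<sigma>2 \<A> \<theta> \<longleftrightarrow>
     binary_matrix (Gz \<theta>) \<and> binary_matrix (Ga \<theta>) \<and>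
     diffeomorphism_on UNIV (range (mixing \<theta>)) (mixing \<theta>) \<and> closed (range (mixing \<theta>)) \<and>
     (\<exists>(M :: ((nat \<Rightarrow> real^'z) \<times> (nat \<Rightarrow> real^'a) \<times> (nat \<Rightarrow> real^'x)) measure) Z A N X.
        latent_process M T \<sigma>2 \<A> (mixing \<theta>) (trans \<theta>) Z A N X) \<and>
     (\<exists>q. coordinate_densities T \<A> q \<and>
          (\<forall>t\<in>{1..T}. \<forall>z\<in>latent_pasts t. \<forall>a\<in>action_pasts \<A> t. \<forall>y.
             trans \<theta> t z a y = (\<Prod>i\<in>UNIV. q t z a i (y $ i))) \<and>
          respects_graphs T \<A> (Gz \<theta>) (Ga \<theta>) q)"


section \<open>Equivalence relations\<close>

text \<open>The map from the latents of \<open>\<theta>'\<close> to those of \<open>\<theta>\<close>.\<close>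

definition latent_map ::
    "('x::finite, 'z::finite, 'a::finite) latent_triple \<Rightarrow> ('x, 'z, 'a) latent_triple
      \<Rightarrow> real^'z \<Rightarrow> real^'z" where
  "latent_map \<theta> \<theta>' = inv (mixing \<theta>) \<circ> mixing \<theta>'"

definition equiv_diff ::
    "nat \<Rightarrow> (real^'a) set \<Rightarrow> ('x::finite, 'z::finite, 'a::finite) latent_triple
      \<Rightarrow> ('x, 'z, 'a) latent_triple \<Rightarrow> bool" where
  "equiv_diff T \<A> \<theta> \<theta>' \<longleftrightarrow>
     range (mixing \<theta>) = range (mixing \<theta>') \<and>
     (let v = latent_map \<theta> \<theta>' in
      \<forall>t\<in>{1..T}. \<forall>a\<in>action_pasts \<A> t. \<forall>z\<in>latent_pasts t. \<forall>y.
        trans \<theta>' t z a y =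
          trans \<theta> t (\<lambda>s\<in>{1..<t}. v (z s)) a (v y) * \<bar>det (jacobian v (at y))\<bar>)"

definition equiv_con ::
    "nat \<Rightarrow> (real^'a) set \<Rightarrow> ('x::finite, 'z::finite, 'a::finite) latent_triple
      \<Rightarrow> ('x, 'z, 'a) latent_triple \<Rightarrow> bool" where
  "equiv_con T \<A> \<theta> \<theta>' \<longleftrightarrow>
     equiv_diff T \<A> \<theta> \<theta>' \<and>
     (\<exists>P. permutation_matrix P \<and>
          Ga \<theta>' = P ** Ga \<theta> \<and> Gz \<theta>' = P ** Gz \<theta> ** transpose P \<and>
          (\<exists>c. diffeomorphism_on UNIV UNIV c \<and>
               fun_preserving (Ga \<theta>) c \<and> fun_preserving (Gz \<theta>) c \<and>
               fun_preserving (transpose (Gz \<theta>)) c \<and>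
               latent_map \<theta> \<theta>' = c \<circ> (\<lambda>x. transpose P *v x)))"

definition equiv_perm ::
    "nat \<Rightarrow> (real^'a) set \<Rightarrow> ('x::finite, 'z::finite, 'a::finite) latent_triple
      \<Rightarrow> ('x, 'z, 'a) latent_triple \<Rightarrow> bool" where
  "equiv_perm T \<A> \<theta> \<theta>' \<longleftrightarrow>
     equiv_diff T \<A> \<theta> \<theta>' \<and>
     (\<exists>P. permutation_matrix P \<and>
          Ga \<theta>' = P ** Ga \<theta> \<and> Gz \<theta>' = P ** Gz \<theta> ** transpose P \<and>
          (\<exists>d. elementwise d \<and> latent_map \<theta> \<theta>' = d \<circ> (\<lambda>x. transpose P *v x)))"


section \<open>Graphical criterion\<close>

definition parents :: "real^'n^'m \<Rightarrow> 'm \<Rightarrow> 'n set" where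
  "parents G i = {j. G $ i $ j = 1}"

definition children :: "real^'n^'m \<Rightarrow> 'n \<Rightarrow> 'm set" where
  "children G j = {i. G $ i $ j = 1}"

definition graphical_criterion :: "real^'z^'z \<Rightarrow> real^'a^'z \<Rightarrow> bool" where
  "graphical_criterion Hz Ha \<longleftrightarrow>
     (\<forall>i. (\<Inter>j\<in>children Hz i. parents Hz j) \<inter>
          (\<Inter>j\<in>parents Hz i. children Hz j) \<inter>
          (\<Inter>l\<in>parents Ha i. children Ha l) = {i})"

end

(*
  Testing preservation on single-entry matrices shows that if c_i depends on its j-th argument, then
  row i of the preserved graph is contained in row j. Applied to G^a, G^z and the transpose of G^z,
  this puts j in the i-th intersection of the graphical criterion, so j = i. Hence c is elementwise
  and the permutation of the first equivalence serves for the second.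
*)
theory Submission
  imports Defs
begin

lemma matrix_preserving_rows:
  fixes B :: "real^'n^'m"
  assumes "matrix_preserving B C" and "C $ i $ j \<noteq> 0" and "B $ i $ k \<noteq> 0"
  shows "B $ j $ k \<noteq> 0"
proof
  assume B0: "B $ j $ k = 0"
  \<comment> \<open>The matrix unit at (i, k) obeys the mask because
    \<open>B $ i $ k \<noteq> 0\<close>. Multiplying by \<open>transpose C\<close> puts
    \<open>C $ i $ j\<close> at position (j, k), where the mask would force a zero.\<close>
  define M :: "real^'n^'m" where "M = (\<chi> r s. if r = i \<and> s = k then 1 else 0)"
  have "M \<in> masked_matrices B"
    using assms(3) by (auto simp: masked_matrices_def M_def)
  then have "transpose C ** M \<in> masked_matrices B"
    using assms(1) by (auto simp: matrix_preserving_def)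
  then have "(transpose C ** M) $ j $ k = 0"
    using B0 by (simp add: masked_matrices_def)
  moreover have "(transpose C ** M) $ j $ k = C $ i $ j"
    by (simp add: matrix_matrix_mult_def transpose_def M_def if_distrib cong: if_cong)
  ultimately show False
    using assms(2) by simp
qed

text \<open>Preservation only sees which entries vanish, while \<open>parents\<close> asks for
  entries equal to 1; for a binary matrix the two agree.\<close>

lemma fun_preserving_parents:
  assumes "binary_matrix B" and "fun_preserving B c" and "depends_on_arg c i j"
  shows "parents B i \<subseteq> parents B j"
proof
  fix k
  assume "k \<in> parents B i"
  then have "B $ i $ k \<noteq> 0"
    by (simp add: parents_def)
  moreover have "dependency_graph c $ i $ j \<noteq> 0"
    using assms(3) by (simp add: dependency_graph_def)
  ultimately have "B $ j $ k \<noteq> 0"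
    using assms(2) matrix_preserving_rows unfolding fun_preserving_def by blast
  then show "k \<in> parents B j"
    using assms(1) unfolding binary_matrix_def parents_def by blast
qed

lemma binary_matrix_transpose: "binary_matrix (transpose B) \<longleftrightarrow> binary_matrix B"
  by (auto simp: binary_matrix_def transpose_def)

lemma parents_transpose: "parents (transpose B) = children B"
  by (simp add: fun_eq_iff parents_def children_def transpose_def)

text \<open>\<open>depends_on_arg\<close> varies a single argument, whereas
  \<open>elementwise\<close> lets all arguments but the i-th vary at once. As there are finitely
  many, x can be turned into y one coordinate at a time.\<close>

lemma elementwiseI:
  fixes d :: "real^'n \<Rightarrow> real^'n"
  assumes "\<And>i j. depends_on_arg d i j \<Longrightarrow> j = i"
  shows "elementwise d"
  unfolding elementwise_def
proof (intro allI impI)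
  fix i and x y :: "real^'n"
  assume eq: "x $ i = y $ i"
  \<comment> \<open>S collects the coordinates already switched from x to y; S = \<open>UNIV\<close>
    gives y itself.\<close>
  have "d (\<chi> k. if k \<in> S then y $ k else x $ k) $ i = d x $ i" if "finite S" for S
    using that
  proof induction
    case empty
    then show ?case by simp
  next
    case (insert j S)
    let ?mix = "\<lambda>S. \<chi> k. if k \<in> S then y $ k else x $ k"
    have "d (?mix (insert j S)) $ i = d (?mix S) $ i"
    \<comment> \<open>Switching coordinate i leaves the vector unchanged, since x and y agree there;
      any other switch is invisible to the i-th output.\<close>
    proof (cases "j = i")
      case True
      then have "?mix (insert j S) = ?mix S"
        using eq by (auto simp: vec_eq_iff)
      then show ?thesis by simp
    next
      case False
      then have "\<not> depends_on_arg d i j"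
        using assms by blast
      moreover have "\<forall>k. k \<noteq> j \<longrightarrow> ?mix (insert j S) $ k = ?mix S $ k"
        by simp
      ultimately show ?thesis
        unfolding depends_on_arg_def by blast
    qed
    with insert.IH show ?case by simp
  qed
  from this[of UNIV] show "d x $ i = d y $ i" by simp
qed

lemma elementwise_of_graphical_criterion:
  assumes "binary_matrix Hz" and "binary_matrix Ha"
    and "graphical_criterion Hz Ha"
    and "fun_preserving Ha c" and "fun_preserving Hz c" and "fun_preserving (transpose Hz) c"
  shows "elementwise c"
proof (rule elementwiseI)
  fix i j
  assume dep: "depends_on_arg c i j"
  have "parents Hz i \<subseteq> parents Hz j" "parents Ha i \<subseteq> parents Ha j"
    using assms dep by (auto dest: fun_preserving_parents)
  moreover have "children Hz i \<subseteq> children Hz j"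
    using fun_preserving_parents[OF _ assms(6) dep] assms(1)
    by (simp add: binary_matrix_transpose parents_transpose)
  \<comment> \<open>The roles cross over: the inclusion of children gives the intersection of parent
    sets, and the two inclusions of parents give the intersections of child sets.\<close>
  ultimately have "j \<in> (\<Inter>k\<in>children Hz i. parents Hz k) \<inter>
      (\<Inter>k\<in>parents Hz i. children Hz k) \<inter> (\<Inter>l\<in>parents Ha i. children Ha l)"
    by (auto simp: parents_def children_def)
  then show "j = i"
    using assms(3) unfolding graphical_criterion_def by blast
qed

theorem proposition7:
  fixes T :: nat
    and \<sigma>2 :: real
    and \<A> :: "(real^'a) set"
    and \<theta> \<theta>' :: "('x::finite, 'z::finite, 'a::finite) latent_triple"
  assumes "1 \<le> T"
    and "CARD('z) \<le> CARD('x)"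
    and "0 \<le> \<sigma>2"
    and "\<A> \<noteq> {}"
    and "graphical_latent_model T \<sigma>2 \<A> \<theta>"
    and "graphical_latent_model T \<sigma>2 \<A> \<theta>'"
    and "equiv_con T \<A> \<theta> \<theta>'"
    and "graphical_criterion (Gz \<theta>) (Ga \<theta>)"
  shows "equiv_perm T \<A> \<theta> \<theta>'"
proof -
  have binary: "binary_matrix (Gz \<theta>)" "binary_matrix (Ga \<theta>)"
    using assms(5) by (simp_all add: graphical_latent_model_def)
  show ?thesis
    using assms(7) elementwise_of_graphical_criterion[OF binary assms(8)]
    unfolding equiv_con_def equiv_perm_def by blast
qed

end
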